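(* Let $a<b$ be real numbers and let $f:[a,b]\to\mathbb{R}$ be continuous and such that $$M:=\max_{a\le t\le b} f(t)=-\min_{a\le t\le b} f(t)>0 .$$ Let $\beta\in(0,1]$. 1. There exist an integer $k(\beta)\ge1$, $\varepsilon(\beta)\in\{-1,1\}$ and reals $t_i^-(\beta),t_i^+(\beta)$, $i=0,\dots,k(\beta)$, such that $$a\le t_0^-(\beta)\le t_0^+(\beta),\qquad t_{k(\beta)}^-(\beta)\le t_{k(\beta)}^+(\beta)\le b,$$ $$t_i^-(\beta)\le t_i^+(\beta)<t_{i+1}^-(\beta)\le t_{i+1}^+(\beta),\quad i=0,\dots,k(\beta)-1,$$ $$-\beta M<\varepsilon(\beta)(-1)^i f(t)\le M\quad\forall\,t\in[t_i^-(\beta),t_i^+(\beta)],\ \forall\, i=0,\dots,k(\beta),$$ $$\varepsilon(\beta)(-1)^i f(t_i^+(\beta))=\varepsilon(\beta)(-1)^{i+1}f(t_{i+1}^-(\beta))=\beta M,\quad i=0,\dots,k(\beta)-1,$$ $$\varepsilon(\beta)f(t_0^-(\beta))\ge\beta M,\qquad \varepsilon(\beta)(-1)^{k(\beta)}f(t_{k(\beta)}^+(\beta))\ge\beta M,$$ $$|f(t)|<\beta M\quad\text{for all other } t\in[a,b].$$ The quantities $\varepsilon(\beta),k(\beta),t_i^-(\beta),t_i^+(\beta)$ are uniquely determined by these conditions. 2. $\|f-p\|\ge\beta\|f\|$ for every polynomial function $p$ of degree at most $k(\beta)-1$. 3. For $i=0,\dots,k(\beta)-1$ let $\xi_i(\beta)$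 be chosen arbitrarily in $(t_i^+(\beta),t_{i+1}^-(\beta))$, and let $$\gamma_\beta(t)=\varepsilon(\beta)\prod_{i=0}^{k(\beta)-1}(\xi_i(\beta)-t).$$ Then there exists $\lambda>0$ such that $\|f-\lambda\gamma_\beta\|<\|f\|$.
   Context: For a continuous $g:[a,b]\to\mathbb{R}$, $\|g\|=\max_{t\in[a,b]}|g(t)|$. *)

theory Defs
  imports "HOL-Analysis.Analysis" "HOL-Computational_Algebra.Polynomial"
begin

(* Only meaningful for g continuous on [a,b] with a \<le> b, where the supremum is attained,
   i.e. a maximum (see sup_norm_attained). *)
definition sup_norm :: "real \<Rightarrow> real \<Rightarrow> (real \<Rightarrow> real) \<Rightarrow> real" where
  "sup_norm a b g = (SUP t\<in>{a..b}. \<bar>g t\<bar>)"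

lemma Sup_attained:
  fixes f :: "real \<Rightarrow> real"
  assumes "a \<le> b" "continuous_on {a..b} f"
  shows "\<exists>t\<in>{a..b}. f t = Sup (f ` {a..b}) \<and> (\<forall>s\<in>{a..b}. f s \<le> f t)"
proof -
  obtain t where t: "t \<in> {a..b}" "\<forall>s\<in>{a..b}. f s \<le> f t"
    using continuous_attains_sup[of "{a..b}" f] assms by auto
  then have "Sup (f ` {a..b}) = f t"
    by (intro cSup_eq_maximum) auto
  with t show ?thesis by auto
qed

lemma Inf_attained:
  fixes f :: "real \<Rightarrow> real"
  assumes "a \<le> b" "continuous_on {a..b} f"
  shows "\<exists>t\<in>{a..b}. f t = Inf (f ` {a..b}) \<and> (\<forall>s\<in>{a..b}. f t \<le> f s)"
proof -
  obtain t where t: "t \<in> {a..b}" "\<forall>s\<in>{a..b}. f t \<le> f s"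
    using continuous_attains_inf[of "{a..b}" f] assms by auto
  then have "Inf (f ` {a..b}) = f t"
    by (intro cInf_eq_minimum) auto
  with t show ?thesis by auto
qed

lemma sup_norm_attained:
  assumes "a \<le> b" "continuous_on {a..b} g"
  shows "\<exists>t\<in>{a..b}. \<bar>g t\<bar> = sup_norm a b g \<and> (\<forall>s\<in>{a..b}. \<bar>g s\<bar> \<le> \<bar>g t\<bar>)"
  using Sup_attained[of a b "\<lambda>t. \<bar>g t\<bar>"] assms
  by (auto simp: sup_norm_def intro: continuous_on_rabs)

(* tm i and tp i are the endpoints t_i^- and t_i^+.  Only the values at i \<le> k matter. *)
definition alternation_data ::
  "real \<Rightarrow> real \<Rightarrow> (real \<Rightarrow> real) \<Rightarrow> real \<Rightarrow> real \<Rightarrow>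
   nat \<Rightarrow> real \<Rightarrow> (nat \<Rightarrow> real) \<Rightarrow> (nat \<Rightarrow> real) \<Rightarrow> bool" where
  "alternation_data a b f M \<beta> k \<epsilon> tm tp \<longleftrightarrow>
     k \<ge> 1 \<and> \<epsilon> \<in> {-1, 1} \<and>
     a \<le> tm 0 \<and> tm 0 \<le> tp 0 \<and> tm k \<le> tp k \<and> tp k \<le> b \<and>
     (\<forall>i<k. tm i \<le> tp i \<and> tp i < tm (i + 1) \<and> tm (i + 1) \<le> tp (i + 1)) \<and>
     (\<forall>i\<le>k. \<forall>t\<in>{tm i..tp i}. - \<beta> * M < \<epsilon> * (-1) ^ i * f t \<and> \<epsilon> * (-1) ^ i * f t \<le> M) \<and>
     (\<forall>i<k. \<epsilon> * (-1) ^ i * f (tp i) = \<beta> * M \<and> \<epsilon> * (-1) ^ (i + 1) * f (tm (i + 1)) = \<beta> * M) \<and>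
     \<epsilon> * f (tm 0) \<ge> \<beta> * M \<and> \<epsilon> * (-1) ^ k * f (tp k) \<ge> \<beta> * M \<and>
     (\<forall>t\<in>{a..b} - (\<Union>i\<le>k. {tm i..tp i}). \<bar>f t\<bar> < \<beta> * M)"

end

theory Submission
  imports Defs
begin

text \<open>
  Put \<open>c = \<beta> M\<close>. The points \<open>t\<^sub>i\<^sup>-\<close> are forced: \<open>t\<^sub>0\<^sup>-\<close> is the first point with
  \<open>\<bar>f\<bar> \<ge> c\<close>, and \<open>t\<^bsub>i+1\<^esub>\<^sup>-\<close> is the first point after \<open>t\<^sub>i\<^sup>-\<close> where \<open>f\<close> reaches the level \<open>c\<close> with
  the opposite sign; \<open>t\<^sub>i\<^sup>+\<close> is the last point before \<open>t\<^bsub>i+1\<^esub>\<^sup>-\<close> (or before \<open>b\<close>) with \<open>\<bar>f\<bar> \<ge> c\<close>.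
  By uniform continuity consecutive \<open>t\<^sub>i\<^sup>-\<close> have a distance bounded below, so the process stops.
  A polynomial closer to \<open>f\<close> than \<open>c\<close> alternates in sign at the \<open>k + 1\<close> points \<open>t\<^sub>i\<^sup>-\<close>
  and therefore has \<open>k\<close> roots. Finally \<open>f \<gamma> > 0\<close> wherever \<open>\<bar>f\<bar> = M\<close>, and a compactness argument
  gives the descent direction.
\<close>

section \<open>Families of alternating intervals at a fixed level c\<close>

locale alternation =
  fixes a b :: real and f :: "real \<Rightarrow> real" and c :: real
    and k :: nat and \<epsilon> :: real and tm tp :: "nat \<Rightarrow> real"
  assumes eps: "\<epsilon> \<in> {-1, 1}"
    and lower: "a \<le> tm 0" and upper: "tp k \<le> b"
    and ordered: "\<And>i. i \<le> k \<Longrightarrow> tm i \<le> tp i"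
    and separated: "\<And>i. i < k \<Longrightarrow> tp i < tm (Suc i)"
    and at_tm: "\<And>i. i \<le> k \<Longrightarrow> c \<le> \<epsilon> * (-1) ^ i * f (tm i)"
    and at_tp: "\<And>i. i \<le> k \<Longrightarrow> c \<le> \<epsilon> * (-1) ^ i * f (tp i)"
    and inside: "\<And>i t. i \<le> k \<Longrightarrow> t \<in> {tm i..tp i} \<Longrightarrow> - c < \<epsilon> * (-1) ^ i * f t"
    and outside: "\<And>t. t \<in> {a..b} \<Longrightarrow> (\<And>i. i \<le> k \<Longrightarrow> t \<notin> {tm i..tp i}) \<Longrightarrow> \<bar>f t\<bar> < c"
begin

lemma abs_sign: "\<bar>\<epsilon> * (-1) ^ i\<bar> = 1"
  using eps by (auto simp: abs_mult power_abs)

lemma abs_signed: "\<bar>\<epsilon> * (-1) ^ i * x\<bar> = \<bar>x\<bar>"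
  using abs_sign[of i] by (simp add: abs_mult)

lemma sign_cases: "\<epsilon> * (-1) ^ i = 1 \<or> \<epsilon> * (-1) ^ i = -1"
  using abs_sign[of i] by linarith

lemma tp_less_tm:
  assumes "i < j" "j \<le> k"
  shows "tp i < tm j"
  using assms
proof (induction j)
  case (Suc j)
  show ?case
  proof (cases "i = j")
    case True
    with Suc.prems show ?thesis using separated by auto
  next
    case False
    with Suc have "tp i < tm j" "tm j \<le> tp j" "tp j < tm (Suc j)"
      using ordered[of j] separated[of j] by auto
    then show ?thesis by linarith
  qed
qed simp

lemma tm_mono: "i \<le> j \<Longrightarrow> j \<le> k \<Longrightarrow> tm i \<le> tm j"
  using tp_less_tm[of i j] ordered[of i] by (cases "i = j") auto

lemma tp_mono: "i \<le> j \<Longrightarrow> j \<le> k \<Longrightarrow> tp i \<le> tp j"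
  using tp_less_tm[of i j] ordered[of j] by (cases "i = j") auto

lemma interval_subset: "i \<le> k \<Longrightarrow> {tm i..tp i} \<subseteq> {a..b}"
  using tm_mono[of 0 i] tp_mono[of i k] lower upper by auto

lemma tm_in: "i \<le> k \<Longrightarrow> tm i \<in> {a..b}" and tp_in: "i \<le> k \<Longrightarrow> tp i \<in> {a..b}"
  using interval_subset[of i] ordered[of i] by auto

lemma large_tm: "i \<le> k \<Longrightarrow> c \<le> \<bar>f (tm i)\<bar>" and large_tp: "i \<le> k \<Longrightarrow> c \<le> \<bar>f (tp i)\<bar>"
  using at_tm[of i] at_tp[of i] abs_signed[of i "f (tm i)"] abs_signed[of i "f (tp i)"]
  by linarith+

lemma large_in_interval:
  assumes "t \<in> {a..b}" "c \<le> \<bar>f t\<bar>"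
  obtains i where "i \<le> k" "t \<in> {tm i..tp i}"
  using outside[of t] assms by force

lemma small_in_gap:
  assumes "i < k" "t \<in> {tp i<..<tm (Suc i)}"
  shows "\<bar>f t\<bar> < c"
proof (rule outside)
  show "t \<in> {a..b}"
    using tp_in[of i] tm_in[of "Suc i"] assms by auto
  show "t \<notin> {tm j..tp j}" if "j \<le> k" for j
  proof (cases "j \<le> i")
    case True
    then show ?thesis using tp_mono[of j i] assms by auto
  next
    case False
    then show ?thesis using tm_mono[of "Suc i" j] that assms by auto
  qed
qed

text \<open>On the open gap |f| < c, so by continuity |f| \<le> c on its closure. With
  \<open>at_tp\<close> and \<open>at_tm\<close> this forces equality at both ends of the
  gap.\<close>

lemma endpoint_values:
  assumes "continuous_on {a..b} f" "i < k"
  shows "\<epsilon> * (-1) ^ i * f (tp i) = c" "\<epsilon> * (-1) ^ i * f (tm (Suc i)) = - c"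
proof -
  have sub: "{tp i..tm (Suc i)} \<subseteq> {a..b}"
    using tp_in[of i] tm_in[of "Suc i"] assms by auto
  have cl: "closure {tp i<..<tm (Suc i)} = {tp i..tm (Suc i)}"
    using separated assms by simp
  have le: "\<bar>f t\<bar> \<le> c" if "t \<in> {tp i..tm (Suc i)}" for t
  proof (rule continuous_le_on_closure[where f = "\<lambda>t. \<bar>f t\<bar>"])
    show "continuous_on (closure {tp i<..<tm (Suc i)}) (\<lambda>t. \<bar>f t\<bar>)"
      unfolding cl using continuous_on_subset[OF assms(1) sub] by (rule continuous_on_rabs)
    show "t \<in> closure {tp i<..<tm (Suc i)}" using that cl by simp
    show "\<bar>f s\<bar> \<le> c" if "s \<in> {tp i<..<tm (Suc i)}" for s
      using small_in_gap[OF assms(2) that] by simp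
  qed
  have "\<bar>f (tp i)\<bar> \<le> c" "\<bar>f (tm (Suc i))\<bar> \<le> c"
    using le separated[OF assms(2)] by auto
  then have "\<epsilon> * (-1) ^ i * f (tp i) \<le> c" "- c \<le> \<epsilon> * (-1) ^ i * f (tm (Suc i))"
    using abs_signed[of i "f (tp i)"] abs_signed[of i "f (tm (Suc i))"] by linarith+
  then show "\<epsilon> * (-1) ^ i * f (tp i) = c" "\<epsilon> * (-1) ^ i * f (tm (Suc i)) = - c"
    using at_tp[of i] at_tm[of "Suc i"] assms(2) by auto
qed

end

text \<open>Transfers the theorem to the locale. From right to left, \<open>endpoint_values\<close>
  supplies the equalities and the global bound on |f| supplies the upper bound M.\<close>

lemma alternation_data_iff:
  assumes "continuous_on {a..b} f" "\<And>t. t \<in> {a..b} \<Longrightarrow> \<bar>f t\<bar> \<le> M"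
  shows "alternation_data a b f M \<beta> k \<epsilon> tm tp \<longleftrightarrow> 1 \<le> k \<and> alternation a b f (\<beta> * M) k \<epsilon> tm tp"
proof (intro iffI conjI)
  assume D: "alternation_data a b f M \<beta> k \<epsilon> tm tp"
  then show "1 \<le> k"
    by (simp add: alternation_data_def)
  show "alternation a b f (\<beta> * M) k \<epsilon> tm tp"
  proof
    show "tm i \<le> tp i" if "i \<le> k" for i
      using D that by (cases "i = k") (auto simp: alternation_data_def)
    show "\<beta> * M \<le> \<epsilon> * (-1) ^ i * f (tm i)" if "i \<le> k" for i
      using D that by (cases i) (auto simp: alternation_data_def)
    show "\<beta> * M \<le> \<epsilon> * (-1) ^ i * f (tp i)" if "i \<le> k" for i
      using D that by (cases "i = k") (auto simp: alternation_data_def)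
  qed (use D in \<open>auto simp: alternation_data_def\<close>)
next
  assume "1 \<le> k \<and> alternation a b f (\<beta> * M) k \<epsilon> tm tp"
  then have k: "1 \<le> k" and D: "alternation a b f (\<beta> * M) k \<epsilon> tm tp"
    by auto
  interpret alternation a b f "\<beta> * M" k \<epsilon> tm tp
    by (fact D)
  have le: "\<epsilon> * (-1) ^ i * f t \<le> M" if "i \<le> k" "t \<in> {tm i..tp i}" for i t
    using abs_signed[of i "f t"] assms(2)[OF subsetD[OF interval_subset[OF that(1)] that(2)]]
    by linarith
  show "alternation_data a b f M \<beta> k \<epsilon> tm tp"
    unfolding alternation_data_def
    using k eps lower upper ordered separated inside le endpoint_values[OF assms(1)]
      at_tm[of 0] at_tp[of k] outside
    by auto
qed

section \<open>Existence, by scanning from left to right\<close>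

lemma compact_superlevel:
  fixes f :: "real \<Rightarrow> real"
  assumes "continuous_on {x..y} f"
  shows "compact {t \<in> {x..y}. c \<le> f t}"
proof -
  have "closed {t \<in> {x..y}. f t \<in> {c..}}"
    using continuous_closed_preimage[OF assms, of "{c..}"] by (simp add: vimage_def Int_def)
  then have "compact ({x..y} \<inter> {t \<in> {x..y}. f t \<in> {c..}})"
    by (intro compact_Int_closed) auto
  also have "{x..y} \<inter> {t \<in> {x..y}. f t \<in> {c..}} = {t \<in> {x..y}. c \<le> f t}"
    by auto
  finally show ?thesis .
qed

lemma obtain_first:
  fixes f :: "real \<Rightarrow> real"
  assumes "continuous_on {x..y} f" "u \<in> {x..y}" "c \<le> f u"
  obtains s where "s \<in> {x..y}" "c \<le> f s" "\<And>t. t \<in> {x..<s} \<Longrightarrow> f t < c"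
proof -
  obtain s where s: "s \<in> {t \<in> {x..y}. c \<le> f t}" "\<forall>t\<in>{t \<in> {x..y}. c \<le> f t}. s \<le> t"
    using compact_attains_inf[OF compact_superlevel[OF assms(1), of c]] assms by blast
  have "f t < c" if "t \<in> {x..<s}" for t
    using s that by force
  with s that show thesis by blast
qed

lemma obtain_last:
  fixes f :: "real \<Rightarrow> real"
  assumes "continuous_on {x..y} f" "u \<in> {x..y}" "c \<le> f u"
  obtains s where "s \<in> {x..y}" "c \<le> f s" "\<And>t. t \<in> {s<..y} \<Longrightarrow> f t < c"
proof -
  obtain s where s: "s \<in> {t \<in> {x..y}. c \<le> f t}" "\<forall>t\<in>{t \<in> {x..y}. c \<le> f t}. t \<le> s"
    using compact_attains_sup[OF compact_superlevel[OF assms(1), of c]] assms by blast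
  have "f t < c" if "t \<in> {s<..y}" for t
    using s(1) bspec[OF s(2), of t] that by force
  with s that show thesis by blast
qed

text \<open>Induction on n, with a and u varying because the tail of the family is built on [s, b],
  where s is the first crossing to the opposite sign. By \<open>osc\<close> each crossing uses up a
  length of at least \<delta>. For n = 0 the interval would be empty, contradicting u.\<close>

lemma alternation_exists_aux:
  assumes c: "0 < c" and \<delta>: "0 < \<delta>"
    and "continuous_on {a..b} f"
    and osc: "\<And>s t. s \<in> {a..b} \<Longrightarrow> t \<in> {a..b} \<Longrightarrow> \<bar>s - t\<bar> < \<delta> \<Longrightarrow> \<bar>f s - f t\<bar> < 2 * c"
    and "u \<in> {a..b}" "c \<le> \<bar>f u\<bar>" "b - a < real n * \<delta>"
  shows "\<exists>k \<epsilon> tm tp. alternation a b f c k \<epsilon> tm tp"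
  using assms(3-)
proof (induction n arbitrary: a u)
  case 0
  then show ?case by simp
next
  case (Suc n)
  note cont = Suc.prems(1)
  obtain p where p: "p \<in> {a..b}" "c \<le> \<bar>f p\<bar>" "\<And>t. t \<in> {a..<p} \<Longrightarrow> \<bar>f t\<bar> < c"
    using obtain_first[of a b "\<lambda>t. \<bar>f t\<bar>" u c] cont Suc.prems by (auto intro: continuous_on_rabs)
  define \<epsilon> where "\<epsilon> = sgn (f p)"
  have \<epsilon>: "\<epsilon> \<in> {-1, 1}" "c \<le> \<epsilon> * f p"
    using p c by (auto simp: \<epsilon>_def sgn_if)
  have ab: "\<bar>\<epsilon> * x\<bar> = \<bar>x\<bar>" for x
    using \<epsilon>(1) by auto
  have contp: "continuous_on {p..b} f"
    by (rule continuous_on_subset[OF cont]) (use p in auto)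
  show ?case
  proof (cases "\<exists>t\<in>{p..b}. \<epsilon> * f t \<le> - c")
    \<comment> \<open>Without an opposite crossing, [p, q] is the only interval, and the last large
      point q carries the same sign as p.\<close>
    case False
    obtain q where q: "q \<in> {p..b}" "c \<le> \<bar>f q\<bar>" "\<And>t. t \<in> {q<..b} \<Longrightarrow> \<bar>f t\<bar> < c"
      using obtain_last[of p b "\<lambda>t. \<bar>f t\<bar>" p c] contp p by (auto intro: continuous_on_rabs)
    have above: "- c < \<epsilon> * f t" if "t \<in> {p..b}" for t
      using False that by force
    have "c \<le> \<epsilon> * f q"
      using above[OF q(1)] q(2) ab[of "f q"] by linarith
    moreover have "\<bar>f t\<bar> < c" if "t \<in> {a..b}" "t \<notin> {p..q}" for t
      using p(3)[of t] q(3)[of t] that by force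
    ultimately have "alternation a b f c 0 \<epsilon> (\<lambda>_. p) (\<lambda>_. q)"
      by unfold_locales (use p q \<epsilon> above in auto)
    then show ?thesis by blast
  next
    case True
    then obtain v where v: "v \<in> {p..b}" "c \<le> - \<epsilon> * f v"
      by auto
    \<comment> \<open>s will be the left end of the next interval, and q below the right end of the
      current one. Strictly between q and s both signs of f stay below c.\<close>
    obtain s where s: "s \<in> {p..b}" "c \<le> - \<epsilon> * f s" "\<And>t. t \<in> {p..<s} \<Longrightarrow> - \<epsilon> * f t < c"
      by (rule obtain_first[of p b "\<lambda>t. - \<epsilon> * f t" v c])
        (use contp v in \<open>auto intro!: continuous_intros\<close>)
    have "continuous_on {p..s} (\<lambda>t. \<epsilon> * f t)"
      by (intro continuous_intros continuous_on_subset[OF cont]) (use p s in auto)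
    then obtain q where q: "q \<in> {p..s}" "c \<le> \<epsilon> * f q" "\<And>t. t \<in> {q<..s} \<Longrightarrow> \<epsilon> * f t < c"
      using obtain_last[of p s "\<lambda>t. \<epsilon> * f t" p c] \<epsilon> s by auto
    have qs: "q < s"
      using q s c by (cases "q = s") auto
    have "2 * c \<le> \<bar>f s - f p\<bar>"
      using \<epsilon> s by (auto simp: abs_if)
    then have far: "\<delta> \<le> s - p"
      using Suc.prems(2)[of s p] p s by fastforce
    have cs: "c \<le> \<bar>f s\<bar>"
      using s(2) ab[of "f s"] by linarith
    obtain k \<epsilon>' tm tp where "alternation s b f c k \<epsilon>' tm tp"
    proof -
      have "b - s < real n * \<delta>"
        using far Suc.prems(5) p by (auto simp: algebra_simps)
      moreover have "continuous_on {s..b} f"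
        by (rule continuous_on_subset[OF cont]) (use p s in auto)
      ultimately have "\<exists>k \<epsilon> tm tp. alternation s b f c k \<epsilon> tm tp"
        using s p cs Suc.prems(2) by (intro Suc.IH[of s s]) auto
      then show thesis using that by blast
    qed
    then interpret D: alternation s b f c k \<epsilon>' tm tp .
    \<comment> \<open>The tail must start exactly at s: the large point s lies in one of its
      intervals, and none of them begins before s.\<close>
    have tm0: "tm 0 = s"
    proof -
      obtain i where "i \<le> k" "s \<in> {tm i..tp i}"
        using D.large_in_interval[of s] s cs by auto
      then show ?thesis
        using D.tm_mono[of 0 i] D.lower by auto
    qed
    have \<epsilon>': "\<epsilon>' = - \<epsilon>"
      using D.eps \<epsilon> D.at_tm[of 0] s(2) c by (auto simp: tm0)
    \<comment> \<open>\<open>case_nat\<close> puts [p, q] in front of the tail and shifts its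
      indices by one; the shift agrees with the sign change \<epsilon>' = - \<epsilon>.\<close>
    have "alternation a b f c (Suc k) \<epsilon> (case_nat p tm) (case_nat q tp)"
    proof
      fix t assume t: "t \<in> {a..b}" "\<And>i. i \<le> Suc k \<Longrightarrow> t \<notin> {case_nat p tm i..case_nat q tp i}"
      have nin: "t \<notin> {p..q}" "\<And>i. i \<le> k \<Longrightarrow> t \<notin> {tm i..tp i}"
        using t(2)[of 0] t(2)[of "Suc i" for i] by auto
      show "\<bar>f t\<bar> < c"
      proof (cases "t < p \<or> s \<le> t")
        case True
        then show ?thesis using p(3)[of t] D.outside[of t] t(1) nin by auto
      next
        case False
        then have "- \<epsilon> * f t < c" "\<epsilon> * f t < c"
          using s(3)[of t] q(3)[of t] nin(1) by auto
        then show ?thesis using ab[of "f t"] by linarith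
      qed
    next
      show "- c < \<epsilon> * (- 1) ^ i * f t"
        if "i \<le> Suc k" "t \<in> {case_nat p tm i..case_nat q tp i}" for i t
      proof (cases i)
        case 0
        then show ?thesis using s(3)[of t] that qs by auto
      next
        case (Suc j)
        then show ?thesis using D.inside[of j t] that by (simp add: \<epsilon>')
      qed
    qed (use p q s \<epsilon> qs tm0 D.upper D.ordered D.separated D.at_tm D.at_tp
          in \<open>auto simp: \<epsilon>' split: nat.split\<close>)
    then show ?thesis by blast
  qed
qed

lemma alternation_exists:
  assumes "continuous_on {a..b} f" "0 < c" "u \<in> {a..b}" "c \<le> \<bar>f u\<bar>"
  shows "\<exists>k \<epsilon> tm tp. alternation a b f c k \<epsilon> tm tp"
proof -
  have "uniformly_continuous_on {a..b} f"
    using assms(1) by (rule compact_uniformly_continuous) simp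
  \<comment> \<open>The tolerance 2 c is the least jump of f between points at levels c and -
    c.\<close>
  then obtain \<delta> where \<delta>: "0 < \<delta>"
    "\<And>s t. s \<in> {a..b} \<Longrightarrow> t \<in> {a..b} \<Longrightarrow> \<bar>s - t\<bar> < \<delta> \<Longrightarrow> \<bar>f s - f t\<bar> < 2 * c"
    using assms(2) by (force simp: uniformly_continuous_on_def dist_real_def)
  obtain n where "b - a < real n * \<delta>"
    using reals_Archimedean3[OF \<delta>(1)] by blast
  then show ?thesis
    using alternation_exists_aux[OF assms(2) \<delta>(1) assms(1) \<delta>(2) assms(3,4)] by blast
qed

section \<open>Uniqueness, by comparing two families in both directions\<close>

text \<open>The point \<open>tm' 0\<close> is large, so it lies in some interval of the first
  family.\<close>

lemma alternation_tm_0_le: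
  assumes "alternation a b f c k \<epsilon> tm tp" "alternation a b f c k' \<epsilon>' tm' tp'"
  shows "tm 0 \<le> tm' 0"
proof -
  interpret D: alternation a b f c k \<epsilon> tm tp by fact
  interpret E: alternation a b f c k' \<epsilon>' tm' tp' by fact
  obtain i where "i \<le> k" "tm' 0 \<in> {tm i..tp i}"
    using D.large_in_interval[OF E.tm_in E.large_tm] by blast
  then show ?thesis
    using D.tm_mono[of 0 i] by auto
qed

text \<open>The large point \<open>tm' (Suc i)\<close> lies in some interval j of the first family.
  It is to the right of \<open>tm i\<close>, so j < i fails; f has the opposite sign there at level
  c, so \<open>inside\<close> excludes j = i. The conclusion i < k is what later compares the
  lengths of the families.\<close>

lemma alternation_tm_Suc_le:
  assumes "alternation a b f c k \<epsilon> tm tp" "alternation a b f c k' \<epsilon> tm' tp'"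
    and "tm i = tm' i" "i \<le> k" "i < k'"
  shows "i < k \<and> tm (Suc i) \<le> tm' (Suc i)"
proof -
  interpret D: alternation a b f c k \<epsilon> tm tp by fact
  interpret E: alternation a b f c k' \<epsilon> tm' tp' by fact
  obtain j where j: "j \<le> k" "tm' (Suc i) \<in> {tm j..tp j}"
    using D.large_in_interval[OF E.tm_in E.large_tm] assms(5) by (metis Suc_leI)
  have "tm i < tm' (Suc i)"
    using E.separated[of i] E.ordered[of i] assms by auto
  then have "\<not> j < i"
    using D.tp_less_tm[of j i] assms(4) j by auto
  moreover have "j \<noteq> i"
    using D.inside[of j "tm' (Suc i)"] E.at_tm[of "Suc i"] j assms(5) by auto
  ultimately show ?thesis
    using D.tm_mono[of "Suc i" j] j by auto
qed

text \<open>The large point \<open>tp' i\<close> lies in interval j of the first family, and j > i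
  is impossible because the left ends coincide.\<close>

lemma alternation_tp_le:
  assumes "alternation a b f c k \<epsilon> tm tp" "alternation a b f c k \<epsilon> tm' tp'"
    and "\<And>i. i \<le> k \<Longrightarrow> tm i = tm' i" "i \<le> k"
  shows "tp' i \<le> tp i"
proof -
  interpret D: alternation a b f c k \<epsilon> tm tp by fact
  interpret E: alternation a b f c k \<epsilon> tm' tp' by fact
  obtain j where j: "j \<le> k" "tp' i \<in> {tm j..tp j}"
    using D.large_in_interval[OF E.tp_in E.large_tp] assms(4) by blast
  have "\<not> i < j"
    using E.tp_less_tm[of i j] j assms(3)[of j] by auto
  then show ?thesis
    using D.tp_mono[of j i] j assms(4) by auto
qed

lemma alternation_unique:
  assumes "0 < c" and D: "alternation a b f c k \<epsilon> tm tp"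
    and E: "alternation a b f c k' \<epsilon>' tm' tp'"
  shows "k = k' \<and> \<epsilon> = \<epsilon>' \<and> (\<forall>i\<le>k. tm i = tm' i \<and> tp i = tp' i)"
proof -
  have tm0: "tm 0 = tm' 0"
    using alternation_tm_0_le[OF D E] alternation_tm_0_le[OF E D] by simp
  have eps: "\<epsilon> = \<epsilon>'"
    using alternation.at_tm[OF D, of 0] alternation.at_tm[OF E, of 0]
      alternation.eps[OF D] alternation.eps[OF E] tm0 \<open>0 < c\<close> by auto
  note E = E[folded eps]
  have tm: "i \<le> k \<Longrightarrow> i \<le> k' \<Longrightarrow> tm i = tm' i" for i
  proof (induction i)
    case (Suc i)
    then show ?case
      using alternation_tm_Suc_le[OF D E, of i] alternation_tm_Suc_le[OF E D, of i] by auto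
  qed (use tm0 in simp)
  \<comment> \<open>If k < k', the comparison at the last index i = k would yield k < k.\<close>
  have "\<not> k < k'"
    using alternation_tm_Suc_le[OF D E, of k] tm[of k] by auto
  moreover have "\<not> k' < k"
    using alternation_tm_Suc_le[OF E D, of k'] tm[of k'] by auto
  ultimately have k: "k = k'" by simp
  have "tp i = tp' i" if "i \<le> k" for i
    using alternation_tp_le[OF D E[folded k], of i] alternation_tp_le[OF E[folded k] D, of i]
      tm k that by (simp add: order_antisym)
  with tm k eps show ?thesis by simp
qed

section \<open>Lower bound for polynomial approximation\<close>

text \<open>The intermediate value theorem gives a root in each of the k disjoint open intervals
  between consecutive nodes.\<close>

lemma card_roots_ge_sign_changes:
  fixes p :: "real poly"
  assumes "\<And>i. i < k \<Longrightarrow> x i < x (Suc i)" "\<And>i. i < k \<Longrightarrow> poly p (x i) * poly p (x (Suc i)) < 0"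
    and "p \<noteq> 0"
  shows "k \<le> card {t. poly p t = 0}"
proof -
  have "\<exists>r. x i < r \<and> r < x (Suc i) \<and> poly p r = 0" if "i < k" for i
    using poly_IVT[OF assms(1,2)[OF that]] by blast
  then obtain r where r: "\<And>i. i < k \<Longrightarrow> x i < r i \<and> r i < x (Suc i) \<and> poly p (r i) = 0"
    by metis
  have mono: "x i \<le> x j" if "i \<le> j" "j \<le> k" for i j
    using that
  proof (induction j)
    case (Suc j)
    then show ?case
      using assms(1)[of j] by (cases "i = Suc j") auto
  qed simp
  have "inj_on r {..<k}"
  proof (rule linorder_inj_onI)
    fix i j assume "i < j" "i \<in> {..<k}" "j \<in> {..<k}"
    then have "r i < x (Suc i)" "x (Suc i) \<le> x j" "x j < r j"
      using r mono by auto
    then show "r i \<noteq> r j" by simp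
  qed auto
  then have "k = card (r ` {..<k})"
    by (simp add: card_image)
  also have "\<dots> \<le> card {t. poly p t = 0}"
    using r by (intro card_mono poly_roots_finite assms(3)) auto
  finally show ?thesis .
qed

lemma abs_le_sup_norm:
  assumes "a \<le> b" "continuous_on {a..b} g" "t \<in> {a..b}"
  shows "\<bar>g t\<bar> \<le> sup_norm a b g"
  using sup_norm_attained[OF assms(1,2)] assms(3) by auto

text \<open>The supremum is attained, so a strict pointwise bound stays strict.\<close>

lemma sup_norm_less_iff:
  assumes "a \<le> b" "continuous_on {a..b} g"
  shows "sup_norm a b g < C \<longleftrightarrow> (\<forall>t\<in>{a..b}. \<bar>g t\<bar> < C)"
  using sup_norm_attained[OF assms] by force

lemma (in alternation) sup_norm_diff_poly_ge:
  assumes "continuous_on {a..b} f" "0 < c" "1 \<le> k" "degree p \<le> k - 1"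
  shows "c \<le> sup_norm a b (\<lambda>t. f t - poly p t)"
proof (rule ccontr)
  assume less: "\<not> ?thesis"
  have "a \<le> b"
    using tm_in[of 0] by auto
  have "continuous_on {a..b} (\<lambda>t. f t - poly p t)"
    by (intro continuous_intros assms(1))
  then have "\<bar>f t - poly p t\<bar> < c" if "t \<in> {a..b}" for t
    using less sup_norm_less_iff[OF \<open>a \<le> b\<close>] that by (meson not_le)
  \<comment> \<open>The signed value of f at \<open>tm i\<close> is at least c, and p differs from f
    by less than c.\<close>
  then have pos: "0 < \<epsilon> * (-1) ^ i * poly p (tm i)" if "i \<le> k" for i
    using at_tm[OF that] sign_cases[of i] tm_in[OF that] by fastforce
  have "poly p (tm i) * poly p (tm (Suc i)) < 0" if "i < k" for i
  proof -
    have "0 < \<epsilon> * (-1) ^ i * poly p (tm i)" "\<epsilon> * (-1) ^ i * poly p (tm (Suc i)) < 0"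
      using pos[of i] pos[of "Suc i"] that by simp_all
    then show ?thesis
      using sign_cases[of i] by (elim disjE) (simp_all add: mult_less_0_iff)
  qed
  moreover have "tm i < tm (Suc i)" if "i < k" for i
    using ordered[of i] separated[of i] that by auto
  moreover have "p \<noteq> 0"
    using pos[of 0] by auto
  ultimately have "k \<le> card {t. poly p t = 0}"
    by (intro card_roots_ge_sign_changes) auto
  also have "\<dots> \<le> degree p"
    by (rule card_poly_roots_bound) fact
  \<comment> \<open>Since 1 \<le> k, the natural-number difference k - 1 is not truncated, so k
    \<le> degree p \<le> k - 1 is absurd.\<close>
  finally show False
    using assms(3,4) by simp
qed

section \<open>A descent direction with prescribed sign changes\<close>

text \<open>\<open>min i k\<close> counts the negated factors; this form lets the induction on k run
  for arbitrary i.\<close>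

lemma prod_change_signs:
  fixes x :: "nat \<Rightarrow> 'a::comm_ring_1"
  shows "(\<Prod>j<k. if j < i then - x j else x j) = (-1) ^ min i k * (\<Prod>j<k. x j)"
  by (induction k) (auto simp: min_def not_less le_Suc_eq)

text \<open>Exactly the nodes \<xi> j with j < i lie to the left of interval i, so exactly i factors
  are negative at t.\<close>

lemma (in alternation) sign_prod_nodes:
  assumes "\<And>j. j < k \<Longrightarrow> \<xi> j \<in> {tp j<..<tm (Suc j)}" "i \<le> k" "t \<in> {tm i..tp i}"
  shows "0 < (-1) ^ i * (\<Prod>j<k. \<xi> j - t)"
proof -
  have "0 < (if j < i then - (\<xi> j - t) else \<xi> j - t)" if "j < k" for j
    using assms(1)[OF that] tm_mono[of "Suc j" i] tp_mono[of i j] that assms(2,3) by auto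
  then have "0 < (\<Prod>j<k. if j < i then - (\<xi> j - t) else \<xi> j - t)"
    by (intro prod_pos) auto
  also have "\<dots> = (-1) ^ i * (\<Prod>j<k. \<xi> j - t)"
    using assms(2) by (subst prod_change_signs) (simp add: min_def)
  finally show ?thesis .
qed

text \<open>Squares replace absolute values. Where f g is bounded below by some m > 0, the linear
  term in \<eta> lowers the square of f; elsewhere that square already lies at least m below that of
  M, which leaves room for a small perturbation.\<close>

lemma descent_direction:
  fixes f g :: "real \<Rightarrow> real"
  assumes "a \<le> b" "continuous_on {a..b} f" "continuous_on {a..b} g"
    and le: "\<And>t. t \<in> {a..b} \<Longrightarrow> \<bar>f t\<bar> \<le> M"
    and pos: "\<And>t. t \<in> {a..b} \<Longrightarrow> \<bar>f t\<bar> = M \<Longrightarrow> 0 < f t * g t"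
  shows "\<exists>\<eta>>0. \<forall>t\<in>{a..b}. \<bar>f t - \<eta> * g t\<bar> < M"
proof -
  \<comment> \<open>At each point one of the two terms is positive, so the minimum m of h over the
    compact interval is positive and no neighbourhood of the extremal points has to be
    chosen.\<close>
  define h where "h t = max (f t * g t) (M\<^sup>2 - (f t)\<^sup>2)" for t
  have "continuous_on {a..b} h"
    unfolding h_def by (intro continuous_intros assms)
  then obtain u where u: "u \<in> {a..b}" "\<And>t. t \<in> {a..b} \<Longrightarrow> h u \<le> h t"
    using continuous_attains_inf[of "{a..b}" h] assms(1) by auto
  define m where "m = h u"
  have M: "0 \<le> M"
    using le[OF u(1)] by linarith
  have m: "0 < m"
  proof (cases "\<bar>f u\<bar> = M")
    case True
    then show ?thesis using pos[OF u(1)] by (simp add: m_def h_def)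
  next
    case False
    then have "\<bar>f u\<bar>\<^sup>2 < M\<^sup>2"
      using le[OF u(1)] by (intro power_strict_mono) auto
    then show ?thesis by (simp add: m_def h_def less_max_iff_disj)
  qed
  have "continuous_on {a..b} (\<lambda>t. (g t)\<^sup>2)"
    by (intro continuous_intros assms)
  then obtain w where w: "w \<in> {a..b}" "\<And>t. t \<in> {a..b} \<Longrightarrow> (g t)\<^sup>2 \<le> (g w)\<^sup>2"
    using continuous_attains_sup[of "{a..b}" "\<lambda>t. (g t)\<^sup>2"] assms(1) by auto
  define G where "G = (g w)\<^sup>2"
  \<comment> \<open>In the second case below the perturbation is at most \<eta>
    (\<open>M\<^sup>2\<close> + 2 G) = \<eta> (K - 1), hence below m once \<eta> K \<le> m. The
    bound \<eta> \<le> 1 serves to replace \<eta> * \<eta> by \<eta>.\<close>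
  define K where "K = M\<^sup>2 + 2 * G + 1"
  have G: "0 \<le> G" and K: "0 < K"
    by (auto simp: G_def K_def add_nonneg_pos)
  define \<eta> where "\<eta> = min 1 (m / K)"
  have \<eta>: "0 < \<eta>" "\<eta> \<le> 1" "\<eta> * K \<le> m"
    using m K by (auto simp: \<eta>_def min_def field_simps)
  have "\<bar>f t - \<eta> * g t\<bar> < M" if t: "t \<in> {a..b}" for t
  proof -
    have fM: "(f t)\<^sup>2 \<le> M\<^sup>2"
      using le[OF t] M by (metis abs_le_square_iff abs_of_nonneg)
    have gG: "(g t)\<^sup>2 \<le> G"
      using w(2)[OF t] by (simp add: G_def)
    have "\<eta> * \<eta> \<le> \<eta>"
      using \<eta> by (simp add: mult_left_le)
    have \<eta>K: "\<eta> * M\<^sup>2 + 2 * (\<eta> * G) + \<eta> \<le> m"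
      using \<eta>(3) by (simp add: K_def algebra_simps)
    have \<eta>M: "0 \<le> \<eta> * M\<^sup>2" and \<eta>G: "0 \<le> \<eta> * G"
      using \<eta>(1) G by auto
    have expand: "(f t - \<eta> * g t)\<^sup>2 = (f t)\<^sup>2 - 2 * \<eta> * (f t * g t) + \<eta> * \<eta> * (g t)\<^sup>2"
      by (simp add: power2_eq_square algebra_simps)
    have "(f t - \<eta> * g t)\<^sup>2 < M\<^sup>2"
    proof (cases "m \<le> f t * g t")
      case True
      have "\<eta> * \<eta> * (g t)\<^sup>2 \<le> \<eta> * \<eta> * G"
        using gG \<eta>(1) by (intro mult_left_mono) auto
      also have "\<dots> \<le> \<eta> * m"
        using \<eta>K \<eta>M \<eta>G \<eta>(1) by (subst mult.assoc) (intro mult_left_mono; linarith)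
      finally have "\<eta> * \<eta> * (g t)\<^sup>2 \<le> \<eta> * m" .
      moreover have "\<eta> * m \<le> \<eta> * (f t * g t)"
        using True \<eta>(1) by (intro mult_left_mono) auto
      moreover have "0 < \<eta> * m"
        using \<eta>(1) m by simp
      ultimately show ?thesis
        unfolding expand using fM by linarith
    next
      case False
      then have "m \<le> M\<^sup>2 - (f t)\<^sup>2"
        using u(2)[OF t] by (auto simp: m_def h_def le_max_iff_disj)
      moreover have "\<eta> * \<eta> * (g t)\<^sup>2 \<le> \<eta> * G"
        using gG \<open>\<eta> * \<eta> \<le> \<eta>\<close> \<eta>(1) by (intro mult_mono) auto
      moreover have "- 2 * \<eta> * (f t * g t) \<le> \<eta> * M\<^sup>2 + \<eta> * G"
      proof -
        have "0 \<le> (f t + g t)\<^sup>2" by simp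
        then have "- 2 * (f t * g t) \<le> M\<^sup>2 + G"
          using fM gG by (simp add: power2_sum)
        then have "\<eta> * (- 2 * (f t * g t)) \<le> \<eta> * (M\<^sup>2 + G)"
          using \<eta>(1) by (intro mult_left_mono) auto
        then show ?thesis by (simp add: algebra_simps)
      qed
      ultimately show ?thesis
        unfolding expand using \<eta>K \<eta>(1) by linarith
    qed
    then show ?thesis
      using M by (metis abs_of_nonneg power2_abs power2_less_imp_less)
  qed
  with \<eta>(1) show ?thesis by blast
qed

lemma (in alternation) descent:
  assumes "continuous_on {a..b} f" "c \<le> M" and le: "\<And>t. t \<in> {a..b} \<Longrightarrow> \<bar>f t\<bar> \<le> M"
    and "0 < M"
    and \<xi>: "\<And>j. j < k \<Longrightarrow> \<xi> j \<in> {tp j<..<tm (Suc j)}"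
  shows "\<exists>\<eta>>0. sup_norm a b (\<lambda>t. f t - \<eta> * (\<epsilon> * (\<Prod>j<k. \<xi> j - t))) < M"
proof -
  have "a \<le> b"
    using tm_in[of 0] by auto
  have cont: "continuous_on {a..b} (\<lambda>t. \<epsilon> * (\<Prod>j<k. \<xi> j - t))"
    by (intro continuous_intros)
  have "0 < f t * (\<epsilon> * (\<Prod>j<k. \<xi> j - t))" if t: "t \<in> {a..b}" "\<bar>f t\<bar> = M" for t
  proof -
    obtain i where i: "i \<le> k" "t \<in> {tm i..tp i}"
      using large_in_interval[of t] t assms(2) by auto
    \<comment> \<open>The signed value is M or - M, and - M \<le> - c is excluded by
      \<open>inside\<close>.\<close>
    have "\<epsilon> * (-1) ^ i * f t = M"
      using inside[OF i] abs_signed[of i "f t"] t(2) assms(2) by linarith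
    then have "0 < (\<epsilon> * (-1) ^ i * f t) * ((-1) ^ i * (\<Prod>j<k. \<xi> j - t))"
      using sign_prod_nodes[OF \<xi> i] \<open>0 < M\<close> by simp
    also have "\<dots> = ((-1) ^ i * (-1) ^ i) * (f t * (\<epsilon> * (\<Prod>j<k. \<xi> j - t)))"
      by (simp only: ac_simps)
    finally show ?thesis
      by (simp flip: power_mult_distrib)
  qed
  then obtain \<eta> where "0 < \<eta>" "\<forall>t\<in>{a..b}. \<bar>f t - \<eta> * (\<epsilon> * (\<Prod>j<k. \<xi> j - t))\<bar> < M"
    using descent_direction[OF \<open>a \<le> b\<close> assms(1) cont le] by blast
  moreover have "continuous_on {a..b} (\<lambda>t. f t - \<eta> * (\<epsilon> * (\<Prod>j<k. \<xi> j - t)))"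
    by (intro continuous_intros assms(1))
  ultimately show ?thesis
    using sup_norm_less_iff[OF \<open>a \<le> b\<close>] by blast
qed

section \<open>Assembly of the three claims\<close>

theorem theorem2p2:
  fixes a b M \<beta> :: real and f :: "real \<Rightarrow> real"
  assumes "a < b"
    and "continuous_on {a..b} f"
    and "M = Sup (f ` {a..b})"
    and "M = - Inf (f ` {a..b})"
    and "M > 0"
    and "\<beta> \<in> {0<..1}"
  shows
    "(\<exists>k \<epsilon> tm tp. alternation_data a b f M \<beta> k \<epsilon> tm tp) \<and>
     (\<forall>k \<epsilon> tm tp k' \<epsilon>' tm' tp'.
        alternation_data a b f M \<beta> k \<epsilon> tm tp \<and> alternation_data a b f M \<beta> k' \<epsilon>' tm' tp' \<longrightarrow>
        k = k' \<and> \<epsilon> = \<epsilon>' \<and> (\<forall>i\<le>k. tm i = tm' i \<and> tp i = tp' i)) \<and>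
     (\<forall>k \<epsilon> tm tp. alternation_data a b f M \<beta> k \<epsilon> tm tp \<longrightarrow>
        (\<forall>p :: real poly. degree p \<le> k - 1 \<longrightarrow>
           sup_norm a b (\<lambda>t. f t - poly p t) \<ge> \<beta> * sup_norm a b f) \<and>
        (\<forall>\<xi> :: nat \<Rightarrow> real. (\<forall>i<k. \<xi> i \<in> {tp i<..<tm (i + 1)}) \<longrightarrow>
           (\<exists>c>0. sup_norm a b (\<lambda>t. f t - c * (\<epsilon> * (\<Prod>i<k. \<xi> i - t))) < sup_norm a b f)))"
proof -
  define c where "c = \<beta> * M"
  have c: "0 < c" "c \<le> M"
    using assms(5,6) by (auto simp: c_def mult_left_le_one_le)
  obtain u where u: "u \<in> {a..b}" "f u = M" "\<And>t. t \<in> {a..b} \<Longrightarrow> f t \<le> M"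
    using Sup_attained[of a b f] assms by auto
  obtain v where v: "v \<in> {a..b}" "f v = - M" "\<And>t. t \<in> {a..b} \<Longrightarrow> - M \<le> f t"
  proof -
    have "Inf (f ` {a..b}) = - M"
      using assms(4) by simp
    then show thesis
      using Inf_attained[of a b f] assms(1,2) that by auto
  qed
  have le: "\<bar>f t\<bar> \<le> M" if "t \<in> {a..b}" for t
    using u(3)[OF that] v(3)[OF that] by linarith
  have norm: "sup_norm a b f = M"
    using sup_norm_attained[of a b f] abs_le_sup_norm[of a b f u] le u assms by fastforce
  note iff = alternation_data_iff[OF assms(2) le, where \<beta> = \<beta>, folded c_def]
  obtain k \<epsilon> tm tp where D: "alternation a b f c k \<epsilon> tm tp"
    using alternation_exists[OF assms(2) c(1) u(1)] u(2) c by auto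
  then interpret D: alternation a b f c k \<epsilon> tm tp .
  \<comment> \<open>A single interval would contain both extremal points u and v; one of them has
    signed value - M \<le> - c, against \<open>inside\<close>.\<close>
  have "1 \<le> k"
  proof (rule ccontr)
    assume "\<not> 1 \<le> k"
    then have "k = 0" by simp
    then have "u \<in> {tm 0..tp 0}" "v \<in> {tm 0..tp 0}"
      using D.large_in_interval[of u] D.large_in_interval[of v] u(1,2) v(1,2) c by auto
    then have "- c < \<epsilon> * M" "- c < \<epsilon> * - M"
      using D.inside[of 0 u] D.inside[of 0 v] u(2) v(2) by auto
    then show False
      using D.eps c by auto
  qed
  with D have ex: "\<exists>k \<epsilon> tm tp. alternation_data a b f M \<beta> k \<epsilon> tm tp"
    using iff by blast
  have uniq: "k = k' \<and> \<epsilon> = \<epsilon>' \<and> (\<forall>i\<le>k. tm i = tm' i \<and> tp i = tp' i)"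
    if "alternation_data a b f M \<beta> k \<epsilon> tm tp" "alternation_data a b f M \<beta> k' \<epsilon>' tm' tp'"
    for k \<epsilon> tm tp k' \<epsilon>' tm' tp'
    using alternation_unique[OF c(1)] that iff by blast
  have poly: "\<beta> * sup_norm a b f \<le> sup_norm a b (\<lambda>t. f t - poly p t)"
    if "alternation_data a b f M \<beta> k \<epsilon> tm tp" "degree p \<le> k - 1" for k \<epsilon> tm tp p
    using alternation.sup_norm_diff_poly_ge[OF _ assms(2) c(1)] that iff
    unfolding norm c_def by blast
  have descent: "\<exists>l>0. sup_norm a b (\<lambda>t. f t - l * (\<epsilon> * (\<Prod>i<k. \<xi> i - t))) < sup_norm a b f"
    if "alternation_data a b f M \<beta> k \<epsilon> tm tp" "\<forall>i<k. \<xi> i \<in> {tp i<..<tm (i + 1)}"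
    for k \<epsilon> tm tp \<xi>
    using alternation.descent[OF _ assms(2) c(2) le assms(5), of k \<epsilon> tm tp \<xi>] that iff
    unfolding norm by simp
  show ?thesis
    by (intro conjI allI impI ex poly descent) (use uniq in blast)+
qed

end
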